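(* Let $A\in IMS2(n,m)$. There exists a data structure of ${\rm O}(nm)$ bits that, given $i,j,k$, decides in constant time whether $A[i][j]\ge k$.
   Context: $IMS2(n,m)$ is the set of two-dimensional integer arrays $A[0..n-1][0..n-1]$ satisfying three conditions: - $A[i][j]\le A[i][j+1]$ for $0\le i<n$ and $0\le j<n-1$; - $A[i][j]\le A[i+1][j]$ for $0\le i<n-1$ and $0\le j<n$; - $0\le A[i][j]<m$ for all $i,j$. Space is measured in bits, in the word-RAM model. *)

theory Defs
  imports Main
begin

definition IMS2 :: "nat \<Rightarrow> nat \<Rightarrow> (nat \<Rightarrow> nat \<Rightarrow> int) set" where
  "IMS2 n m = {A.
     (\<forall>i j. i < n \<longrightarrow> j + 1 < n \<longrightarrow> A i j \<le> A i (j + 1)) \<and>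
     (\<forall>i j. i + 1 < n \<longrightarrow> j < n \<longrightarrow> A i j \<le> A (i + 1) j) \<and>
     (\<forall>i j. i < n \<longrightarrow> j < n \<longrightarrow> 0 \<le> A i j \<and> A i j < int m)}"

text \<open>
  A word RAM with word size \<open>w\<close>: registers and memory cells hold natural numbers below \<open>2 ^ w\<close>,
  arithmetic is modulo \<open>2 ^ w\<close>, and every instruction costs one time unit. A program is a finite
  list of instructions, so it uses only finitely many (directly named) registers; indirect
  addressing is available for memory only. Division by zero yields zero.
\<close>

datatype binop = Add | Sub | Mul | Div | Mod | And | Or | Xor | Shl | Shr

datatype instr =
    Const nat nat
  | Op binop nat nat nat
  | Load nat nat
  | Store nat nat
  | JumpLess nat nat nat

type_synonym program = "instr list"

record state =
  pc :: nat
  reg :: "nat \<Rightarrow> nat"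
  mem :: "nat \<Rightarrow> nat"

fun binop_sem :: "nat \<Rightarrow> binop \<Rightarrow> nat \<Rightarrow> nat \<Rightarrow> nat" where
  "binop_sem w Add x y = (x + y) mod 2 ^ w"
| "binop_sem w Sub x y = (x + (2 ^ w - y)) mod 2 ^ w"
| "binop_sem w Mul x y = (x * y) mod 2 ^ w"
| "binop_sem w Div x y = x div y"
| "binop_sem w Mod x y = x mod y"
| "binop_sem w And x y = semiring_bit_operations_class.and x y"
| "binop_sem w Or x y = semiring_bit_operations_class.or x y"
| "binop_sem w Xor x y = semiring_bit_operations_class.xor x y"
| "binop_sem w Shl x y = take_bit w (push_bit y x)"
| "binop_sem w Shr x y = drop_bit y x"

fun exec :: "nat \<Rightarrow> instr \<Rightarrow> state \<Rightarrow> state" where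
  "exec w (Const d c) s = s\<lparr>pc := pc s + 1, reg := (reg s)(d := c mod 2 ^ w)\<rparr>"
| "exec w (Op f d a b) s =
     s\<lparr>pc := pc s + 1, reg := (reg s)(d := binop_sem w f (reg s a) (reg s b))\<rparr>"
| "exec w (Load d a) s = s\<lparr>pc := pc s + 1, reg := (reg s)(d := mem s (reg s a))\<rparr>"
| "exec w (Store a b) s = s\<lparr>pc := pc s + 1, mem := (mem s)(reg s a := reg s b)\<rparr>"
| "exec w (JumpLess a b l) s = s\<lparr>pc := (if reg s a < reg s b then l else pc s + 1)\<rparr>"

definition halted :: "program \<Rightarrow> state \<Rightarrow> bool" where
  "halted P s \<longleftrightarrow> length P \<le> pc s"

definition step :: "nat \<Rightarrow> program \<Rightarrow> state \<Rightarrow> state" where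
  "step w P s = (if halted P s then s else exec w (P ! pc s) s)"

text \<open>
  A data structure is a bit string, laid out in consecutive memory words starting at address 0
  (low-order bits first); all remaining memory is zero. Its space is the length of the bit string.
\<close>

definition bits_memory :: "nat \<Rightarrow> bool list \<Rightarrow> nat \<Rightarrow> nat" where
  "bits_memory w D a = horner_sum of_bool 2 (take w (drop (a * w) D))"

text \<open>
  The query arguments are passed in registers 0, 1, 2. The word size is a parameter of the machine
  known to the program (register 3); any other information has to come from \<open>D\<close>.
\<close>

definition query_state :: "nat \<Rightarrow> bool list \<Rightarrow> nat \<Rightarrow> nat \<Rightarrow> nat \<Rightarrow> state" where
  "query_state w D i j k =
     \<lparr>pc = 0, reg = (\<lambda>_. 0)(0 := i, 1 := j, 2 := k, 3 := w), mem = bits_memory w D\<rparr>"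

text \<open>
  The program halts after at most \<open>T\<close> steps (halted states are fixed points of \<^term>\<open>step w P\<close>) with
  the truth value \<open>b\<close> in register 0. Scratch use of memory is allowed, but the query must leave
  the memory, hence the data structure, as it was.
\<close>

definition decides_within ::
  "nat \<Rightarrow> program \<Rightarrow> nat \<Rightarrow> bool list \<Rightarrow> nat \<Rightarrow> nat \<Rightarrow> nat \<Rightarrow> bool \<Rightarrow> bool" where
  "decides_within w P T D i j k b \<longleftrightarrow>
     (let s = (step w P ^^ T) (query_state w D i j k)
      in halted P s \<and> reg s 0 = of_bool b \<and> mem s = bits_memory w D)"

end

theory Submission
  imports Defs
begin

text \<open>
  For a threshold \<open>k\<close>, the cells below \<open>k\<close> and the cells at least \<open>k\<close> are separated by a lattice path
  of \<open>2 * n\<close> unit steps, which meets every diagonal \<open>i + n - j = t\<close> exactly once. So \<open>A i j \<ge> k\<close> can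
  be decided from the number of cells below \<open>k\<close> on the diagonal of \<open>(i, j)\<close>, i.e. from a rank query
  in the bit string of the path; no selection is needed. The paths of all thresholds are
  concatenated to a string of \<open>2 * n * m\<close> bits, which is cut into blocks of \<open>F\<close> bits with
  \<open>4 ^ F = \<Theta>(n * m)\<close>. For every block the rank at its start and its bits are stored, in fields of
  \<open>2 * F\<close> bits, and a table with \<open>2 ^ F * F = O(n * m / F)\<close> entries holds the ranks inside all possible
  blocks.
\<close>

section \<open>Straight-line programs\<close>

fun straight :: "instr \<Rightarrow> bool" where
  "straight (Store _ _) = False"
| "straight (JumpLess _ _ _) = False"
| "straight _ = True"

text \<open>Straight-line code never writes memory, so only the registers evolve over a fixed
  \<open>M\<close>. The catch-all clause covers the excluded stores and jumps.\<close>

fun reg_exec :: "nat \<Rightarrow> (nat \<Rightarrow> nat) \<Rightarrow> instr \<Rightarrow> (nat \<Rightarrow> nat) \<Rightarrow> nat \<Rightarrow> nat" where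
  "reg_exec w M (Const d c) r = r(d := c mod 2 ^ w)"
| "reg_exec w M (Op f d a b) r = r(d := binop_sem w f (r a) (r b))"
| "reg_exec w M (Load d a) r = r(d := M (r a))"
| "reg_exec w M _ r = r"

lemma exec_straight:
  "straight c \<Longrightarrow> exec w c s = s\<lparr>pc := Suc (pc s), reg := reg_exec w (mem s) c (reg s)\<rparr>"
  by (cases c) simp_all

fun target :: "instr \<Rightarrow> nat set" where
  "target (Const d _) = {d}"
| "target (Op _ d _ _) = {d}"
| "target (Load d _) = {d}"
| "target _ = {}"

lemma fold_reg_exec_unchanged:
  "\<forall>c \<in> set P. d \<notin> target c \<Longrightarrow> fold (reg_exec w M) P r d = r d"
proof (induction P arbitrary: r)
  case (Cons c P)
  then show ?case by (cases c) auto
qed simp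

text \<open>Without jumps, \<open>t\<close> steps run exactly the first \<open>t\<close>
  instructions; this makes the program length a uniform time bound.\<close>

lemma funpow_step_straight:
  assumes "list_all straight P" "pc s = 0" "t \<le> length P"
  shows "(step w P ^^ t) s = s\<lparr>pc := t, reg := fold (reg_exec w (mem s)) (take t P) (reg s)\<rparr>"
  using assms(3)
proof (induction t)
  case 0
  then show ?case using assms(2) by simp
next
  case (Suc t)
  then have "straight (P ! t)" using assms(1) by (simp add: list_all_length)
  with Suc show ?case
    by (simp add: step_def halted_def exec_straight take_Suc_conv_app_nth)
qed

section \<open>Packed fields\<close>

lemma bit_bits_memory:
  "bit (bits_memory w D a) p \<longleftrightarrow> p < w \<and> a * w + p < length D \<and> D ! (a * w + p)"
  unfolding bits_memory_def by (auto simp: bit_horner_sum_bit_iff possible_bit_def less_diff_conv add.commute)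

lemma bits_memory_less: "bits_memory w D a < 2 ^ w"
proof -
  have "take_bit w (bits_memory w D a) = bits_memory w D a"
    by (rule bit_eqI) (auto simp: bit_take_bit_iff bit_bits_memory)
  then show ?thesis by (metis take_bit_nat_less_exp)
qed

text \<open>Fields do not straddle words: each word holds \<open>w div W\<close> fields, which at most doubles the space.\<close>

definition pack :: "nat \<Rightarrow> nat \<Rightarrow> nat \<Rightarrow> (nat \<Rightarrow> nat) \<Rightarrow> bool list" where
  "pack w W N f = map (\<lambda>z. bit (f ((z div w) * (w div W) + z mod w div W)) (z mod w mod W)) [0..<2 * N * W]"

text \<open>With \<open>g = w div W\<close> fields per word, \<open>w <= 2 * g * W\<close>, so the
  padding at the end of words never pushes field \<open>q < N\<close> beyond the
  \<open>2 * N * W\<close> bits allotted.\<close>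

lemma take_bit_drop_bit_pack:
  assumes "0 < W" "W \<le> w" "q < N"
  shows "take_bit W (drop_bit (q mod (w div W) * W) (bits_memory w (pack w W N f) (q div (w div W))))
    = take_bit W (f q)"
proof (rule bit_eqI)
  fix b
  define g where "g = w div W"
  have g: "0 < g" unfolding g_def using assms by (simp add: div_greater_zero_iff)
  have gw: "g * W \<le> w" unfolding g_def by simp
  have "w < (g + 1) * W" unfolding g_def using assms(1) by (metis dividend_less_div_times mult.commute Suc_eq_plus1 mult_Suc)
  also have "\<dots> \<le> 2 * g * W" using g by simp
  finally have w2: "w \<le> 2 * g * W" by simp
  show "bit (take_bit W (drop_bit (q mod (w div W) * W)
      (bits_memory w (pack w W N f) (q div (w div W))))) b = bit (take_bit W (f q)) b"
  proof (cases "b < W")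
    case True
    define o' where "o' = q mod g * W + b"
    have "q mod g + 1 \<le> g" using g by (simp add: Suc_leI)
    then have "(q mod g + 1) * W \<le> g * W" by (rule mult_right_mono) simp
    with True gw have ow: "o' < w" unfolding o'_def by simp
    \<comment> \<open>Doubling the offset as well lets the bound factor as \<open>2 * W\<close>
      times \<open>q + 1\<close>.\<close>
    have "q div g * w + o' < q div g * (2 * g * W) + (2 * (q mod g) * W + 2 * W)"
    proof -
      have "q div g * w \<le> q div g * (2 * g * W)" using w2 by (rule mult_left_mono) simp
      then show ?thesis using True unfolding o'_def by linarith
    qed
    also have "\<dots> = 2 * W * (q div g * g + q mod g + 1)"
      by (simp only: distrib_left distrib_right mult_1_right mult.commute mult.left_commute)
    also have "\<dots> = 2 * (q + 1) * W" unfolding div_mult_mod_eq by simp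
    also have "\<dots> \<le> 2 * N * W" using assms(3) by (intro mult_right_mono) simp_all
    finally have len: "q div g * w + o' < 2 * N * W" .
    have "(q div g * w + o') div w = q div g" "(q div g * w + o') mod w = o'"
      using ow by simp_all
    moreover have "o' div W = q mod g" "o' mod W = b"
      using True unfolding o'_def by simp_all
    ultimately have "pack w W N f ! (q div g * w + o') = bit (f q) b"
      using len by (simp add: pack_def flip: g_def)
    then show ?thesis using True ow len
      by (simp add: bit_take_bit_iff bit_drop_bit_eq bit_bits_memory pack_def o'_def flip: g_def)
  qed (simp add: bit_take_bit_iff)
qed

text \<open>Registers 9, 10 and 11 hold the field width, the field mask and the number of fields per word.\<close>

definition read_field :: "nat \<Rightarrow> nat \<Rightarrow> program" where
  "read_field d a =
    [Op Div 12 a 11, Op Mod 13 a 11, Op Mul 13 13 9, Load 12 12, Op Shr 12 12 13, Op And d 12 10]"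

text \<open>Registers 12 and 13 are scratch. The condition \<open>a \<noteq> 12\<close> is there
  because the first instruction overwrites register 12 and the second one reads \<open>a\<close>
  again.\<close>

lemma read_field:
  assumes "r 9 = W" "r 10 = 2 ^ W - 1" "r 11 = w div W" "0 < W" "W \<le> w" "r a < N" "a \<noteq> 12"
    and "f (r a) < 2 ^ W"
  obtains u v where "fold (reg_exec w (bits_memory w (pack w W N f))) (read_field d a) r
    = r(12 := u, 13 := v, d := f (r a))"
proof -
  have g: "0 < w div W" using assms by (simp add: div_greater_zero_iff)
  then have "r a mod (w div W) * W \<le> w div W * W" by simp
  also have "\<dots> \<le> w" by simp
  also have "w < 2 ^ w" by simp
  finally have "r a mod (w div W) * W < 2 ^ w" .
  moreover have "and x (2 ^ W - 1) = take_bit W x" for x :: nat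
    by (simp add: take_bit_eq_mask mask_eq_exp_minus_1)
  moreover have "take_bit W (f (r a)) = f (r a)"
    using assms(8) by (simp add: take_bit_nat_eq_self)
  ultimately have "fold (reg_exec w (bits_memory w (pack w W N f))) (read_field d a) r
    = r(12 := drop_bit (r a mod (w div W) * W) (bits_memory w (pack w W N f) (r a div (w div W))),
        13 := r a mod (w div W) * W, d := f (r a))"
    using take_bit_drop_bit_pack[OF assms(4,5,6), of f] assms
    by (simp add: read_field_def fun_upd_twist[of 12 13])
  then show ?thesis by (rule that)
qed

text \<open>Subtracting 1 flips the lowest set bit and everything below it, and nothing else. The
  induction peels off trailing zeros.\<close>

lemma xor_pred_eq_mask:
  fixes y :: nat
  shows "xor (2 ^ e * (2 * y + 1)) (2 ^ e * (2 * y + 1) - 1) = 2 ^ Suc e - 1"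
proof (induction e)
  case 0
  show ?case by (simp add: xor_nat_rec[of "Suc (2 * y)"])
next
  case (Suc e)
  define z where "z = (2::nat) ^ e * (2 * y + 1)"
  have z: "z \<ge> 1" unfolding z_def by (simp add: Suc_le_eq)
  have "xor (2 * z) (2 * z - 1) = 2 * xor z (z - 1) + 1"
  proof -
    have "2 * z - 1 = 2 * (z - 1) + 1" using z by simp
    then show ?thesis by (simp add: xor_nat_rec[of "2 * z"])
  qed
  also have "\<dots> = 2 * (2 ^ Suc e - 1) + 1" using Suc.IH unfolding z_def by simp
  also have "\<dots> = 2 ^ Suc (Suc e) - 1"
    using one_le_power[of "2::nat" "Suc e"] power_Suc[of "2::nat" "Suc e"] by linarith
  finally show ?case unfolding z_def by (simp only: power_Suc mult.assoc)
qed

section \<open>Lipschitz sequences\<close>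

text \<open>The rank inside a block: the popcount of the lowest \<open>r\<close> bits of
  \<open>p\<close>.\<close>

definition delta :: "nat \<Rightarrow> nat \<Rightarrow> nat" where
  "delta p r = (\<Sum>s<r. of_bool (bit p s))"

text \<open>The increments of \<open>G\<close> within block \<open>q\<close>, coded as a number so
  that they can index the table.\<close>

definition pattern :: "(nat \<Rightarrow> nat) \<Rightarrow> nat \<Rightarrow> nat \<Rightarrow> nat" where
  "pattern G F q = horner_sum of_bool 2 (map (\<lambda>s. G (Suc (q * F + s)) \<noteq> G (q * F + s)) [0..<F])"

lemma delta_le: "delta p r \<le> r"
  unfolding delta_def using sum_bounded_above[of "{..<r}" "\<lambda>s. of_bool (bit p s)" "1::nat"] by simp

lemma pattern_less: "pattern G F q < 2 ^ F"
  unfolding pattern_def using horner_sum_of_bool_2_less[of "map (\<lambda>s. G (Suc (q * F + s)) \<noteq> G (q * F + s)) [0..<F]"] by simp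

lemma eq_add_delta_pattern:
  assumes "\<And>x. G x \<le> G (Suc x)" "\<And>x. G (Suc x) \<le> Suc (G x)" "r \<le> F"
  shows "G (q * F + r) = G (q * F) + delta (pattern G F q) r"
  using assms(3)
proof (induction r)
  case 0
  show ?case by (simp add: delta_def)
next
  case (Suc r)
  have "bit (pattern G F q) r \<longleftrightarrow> G (Suc (q * F + r)) \<noteq> G (q * F + r)"
    using Suc.prems by (simp add: pattern_def bit_horner_sum_bit_iff)
  moreover have "G (Suc (q * F + r)) = G (q * F + r) \<or> G (Suc (q * F + r)) = Suc (G (q * F + r))"
    using assms(1,2) le_antisym not_less_eq_eq by metis
  ultimately show ?case using Suc by (auto simp: delta_def)
qed

section \<open>Ranks along the diagonals of a monotone array\<close>

text \<open>Row indices of the cells \<open>(i', i' + n - t)\<close> of the \<open>t\<close>-th diagonal with entry below \<open>k\<close>;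
  cells to the left of the array count as \<open>-\<infinity>\<close>, cells to the right of it as \<open>\<infinity>\<close>.\<close>

definition low_cells :: "(nat \<Rightarrow> nat \<Rightarrow> int) \<Rightarrow> nat \<Rightarrow> nat \<Rightarrow> nat \<Rightarrow> nat set" where
  "low_cells A n k t = {i'. i' < n \<and> i' < t \<and> (i' + n < t \<or> A i' (i' + n - t) < int k)}"

lemma finite_low_cells [simp]: "finite (low_cells A n k t)"
  unfolding low_cells_def by simp

text \<open>In a fixed row, passing to the next diagonal moves one column to the left, where entries
  are no larger.\<close>

lemma low_cells_mono:
  assumes "A \<in> IMS2 n m"
  shows "low_cells A n k t \<subseteq> low_cells A n k (Suc t)"
proof
  fix a assume a: "a \<in> low_cells A n k t"
  show "a \<in> low_cells A n k (Suc t)"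
  proof (cases "a + n < Suc t")
    case True
    then show ?thesis using a by (simp add: low_cells_def)
  next
    case False
    then have "a + n - t = (a + n - Suc t) + 1" "a + n - Suc t + 1 < n" "a < n"
      using a by (auto simp: low_cells_def)
    then have "A a (a + n - Suc t) \<le> A a (a + n - t)"
      using assms unfolding IMS2_def by auto
    then show ?thesis using a False by (auto simp: low_cells_def)
  qed
qed

text \<open>Row \<open>Suc a\<close> of diagonal \<open>Suc t\<close> and row \<open>a\<close> of
  diagonal \<open>t\<close> share a column, so monotonicity down the columns applies.\<close>

lemma low_cells_pred:
  assumes "A \<in> IMS2 n m" "Suc a \<in> low_cells A n k (Suc t)"
  shows "a \<in> low_cells A n k t"
proof (cases "a + n < t")
  case True
  then show ?thesis using assms(2) by (simp add: low_cells_def)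
next
  case False
  then have "a + n - t < n" "a + 1 < n" using assms(2) by (auto simp: low_cells_def)
  then have "A a (a + n - t) \<le> A (a + 1) (a + n - t)"
    using assms(1) unfolding IMS2_def by auto
  then show ?thesis using assms(2) False by (auto simp: low_cells_def)
qed

lemma card_low_cells_Suc_le:
  assumes "A \<in> IMS2 n m"
  shows "card (low_cells A n k (Suc t)) \<le> Suc (card (low_cells A n k t))"
proof -
  have "low_cells A n k (Suc t) \<subseteq> insert 0 (Suc ` low_cells A n k t)"
  proof
    fix a assume "a \<in> low_cells A n k (Suc t)"
    then show "a \<in> insert 0 (Suc ` low_cells A n k t)"
      using low_cells_pred[OF assms] by (cases a) auto
  qed
  then have "card (low_cells A n k (Suc t)) \<le> card (insert 0 (Suc ` low_cells A n k t))"
    by (intro card_mono) auto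
  also have "\<dots> = Suc (card (low_cells A n k t))"
    by (subst card_insert_disjoint) (auto simp: card_image)
  finally show ?thesis .
qed

text \<open>Step to the next diagonal in the same row, then back to the previous diagonal one row
  up. Thus the low cells form an initial segment, determined by its cardinality.\<close>

lemma low_cells_downward:
  assumes "A \<in> IMS2 n m" "a \<in> low_cells A n k t" "b \<le> a"
  shows "b \<in> low_cells A n k t"
  using assms(3,2)
proof (induction rule: inc_induct)
  case (step b)
  then show ?case using low_cells_pred[OF assms(1)] low_cells_mono[OF assms(1)] by blast
qed simp

lemma card_low_cells_le_iff:
  assumes "A \<in> IMS2 n m"
  shows "card (low_cells A n k t) \<le> i \<longleftrightarrow> i \<notin> low_cells A n k t"
proof
  assume "card (low_cells A n k t) \<le> i"
  moreover have "Suc i \<le> card (low_cells A n k t)" if "i \<in> low_cells A n k t"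
  proof -
    have "{..i} \<subseteq> low_cells A n k t" using low_cells_downward[OF assms that] by auto
    then show ?thesis using card_mono[of "low_cells A n k t" "{..i}"] by simp
  qed
  ultimately show "i \<notin> low_cells A n k t" by fastforce
next
  assume "i \<notin> low_cells A n k t"
  then have "low_cells A n k t \<subseteq> {..<i}"
    using low_cells_downward[OF assms] by (metis lessThan_iff not_le subsetI)
  then show "card (low_cells A n k t) \<le> i" using card_mono[of "{..<i}"] by fastforce
qed

text \<open>The ranks of all thresholds form a single sequence: every threshold starts at rank \<open>0\<close> and
  ends at rank \<open>n\<close>, so they can be chained without breaking the Lipschitz property.\<close>

definition rank :: "(nat \<Rightarrow> nat \<Rightarrow> int) \<Rightarrow> nat \<Rightarrow> nat \<Rightarrow> nat" where
  "rank A n x = x div (2 * n) * n + card (low_cells A n (x div (2 * n)) (x mod (2 * n)))"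

text \<open>The formula needs no case split at the end of a threshold: at \<open>t = 2 * n\<close>
  all \<open>n\<close> rows are low, which matches the next threshold starting with none.\<close>

lemma rank_Suc:
  assumes "0 < n"
  shows "rank A n (Suc x) =
    x div (2 * n) * n + card (low_cells A n (x div (2 * n)) (Suc (x mod (2 * n))))"
proof (cases "Suc (x mod (2 * n)) = 2 * n")
  case True
  have "low_cells A n (Suc (x div (2 * n))) 0 = {}"
    "low_cells A n (x div (2 * n)) (2 * n) = {..<n}"
    by (auto simp: low_cells_def)
  then show ?thesis using True by (simp add: rank_def mod_Suc div_Suc)
next
  case False
  then show ?thesis by (simp add: rank_def mod_Suc div_Suc)
qed

lemma rank_mono_Suc:
  assumes "0 < n" "A \<in> IMS2 n m"
  shows "rank A n x \<le> rank A n (Suc x)"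
  unfolding rank_Suc[OF assms(1)] rank_def[of A n x]
  using low_cells_mono[OF assms(2)] by (simp add: card_mono)

lemma rank_Suc_le:
  assumes "0 < n" "A \<in> IMS2 n m"
  shows "rank A n (Suc x) \<le> Suc (rank A n x)"
  unfolding rank_Suc[OF assms(1)] rank_def[of A n x]
  using card_low_cells_Suc_le[OF assms(2)] by simp

text \<open>Used to show that stored ranks fit into a field.\<close>

lemma rank_le:
  assumes "0 < n" "A \<in> IMS2 n m"
  shows "rank A n x \<le> x"
proof (induction x)
  case 0
  show ?case by (simp add: rank_def low_cells_def)
next
  case (Suc x)
  then show ?case using rank_Suc_le[OF assms, of x] by simp
qed

text \<open>Since \<open>i\<close> and \<open>j\<close> are below \<open>n\<close>, the diagonal
  number \<open>i + n - j\<close> is below \<open>2 * n\<close>, so division by \<open>2 * n\<close>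
  recovers the threshold; the offset \<open>k * n\<close> then cancels.\<close>

lemma rank_le_iff:
  assumes "A \<in> IMS2 n m" "i < n" "j < n"
  shows "rank A n (2 * (k * n) + i + n - j) \<le> k * n + i \<longleftrightarrow> int k \<le> A i j"
proof -
  have x: "2 * (k * n) + i + n - j = k * (2 * n) + (i + n - j)" "i + n - j < 2 * n"
    using assms by auto
  have "rank A n (2 * (k * n) + i + n - j) = k * n + card (low_cells A n k (i + n - j))"
    unfolding rank_def x(1) using x(2) by simp
  moreover have "i \<in> low_cells A n k (i + n - j) \<longleftrightarrow> A i j < int k"
    using assms(2,3) by (auto simp: low_cells_def)
  ultimately show ?thesis using card_low_cells_le_iff[OF assms(1)] by (simp add: not_less)
qed

section \<open>The data structure and its query\<close>

text \<open>Field 0 encodes \<open>F\<close> twice: by the position of the only set bit among the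
  lowest \<open>F\<close> bits, and in binary above them. After the table, block-start ranks and
  patterns alternate.\<close>

definition fields :: "nat \<Rightarrow> nat \<Rightarrow> nat \<Rightarrow> (nat \<Rightarrow> nat) \<Rightarrow> nat \<Rightarrow> nat" where
  "fields F n m G a =
    (if a = 0 then 2 ^ F * F + 2 ^ (F - 1)
     else if a = 1 then n
     else if a = 2 then m
     else if a < 3 + 2 ^ F * F then delta ((a - 3) div F) ((a - 3) mod F)
     else let b = a - (3 + 2 ^ F * F)
       in if even b then G (b div 2 * F) else pattern G F (b div 2))"

text \<open>Three header fields, the table, and two fields for each of the
  \<open>L div F + 1\<close> blocks meeting positions \<open>0\<close> to \<open>L\<close>.\<close>

definition num_fields :: "nat \<Rightarrow> nat \<Rightarrow> nat" where
  "num_fields F L = 5 + 2 ^ F * F + 2 * (L div F)"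

text \<open>The lowest set bit of memory word \<open>0\<close> is bit \<open>F - 1\<close>; this is how the program gets hold of the
  field width \<open>2 * F\<close> before it knows how to read a field.\<close>

definition read_header :: program where
  "read_header =
    [Const 4 1, Load 5 6, Op Sub 6 5 4, Op Xor 6 5 6, Op Add 7 6 4, Op Div 8 5 7, Op And 8 8 6,
     Op Add 9 8 8, Op Mul 10 7 6, Op Add 10 10 6, Op Div 11 3 9, Op Add 5 4 4]"

text \<open>Registers 4, 7, 8 and 14 hold \<open>1\<close>, \<open>2 ^ F\<close>, \<open>F\<close>
  and \<open>n\<close>. Register 5 grows from 2 to 3, the number of header fields.\<close>

definition locate :: program where
  "locate =
    [Op Mul 16 2 14, Op Add 17 16 16, Op Add 17 17 0, Op Add 17 17 14, Op Sub 17 17 1,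
     Op Add 16 16 0, Op Add 16 16 4,
     Op Div 18 17 8, Op Mod 19 17 8, Op Mul 20 7 8, Op Add 5 5 4,
     Op Add 18 18 18, Op Add 18 18 20, Op Add 18 18 5]"

definition table_index :: program where
  "table_index = [Op Mul 22 22 8, Op Add 22 22 19, Op Add 22 22 5]"

text \<open>Comparison by division, \<open>x < y\<close> being \<open>1 div (x div y + 1)\<close>. For \<open>k = 2 ^ w - 1\<close> and \<open>m = 1\<close> the
  addition overflows to \<open>0\<close>, and the result is correct because \<open>1 div 0 = 0\<close>.\<close>

definition in_range :: program where
  "in_range = [Op Div 15 2 15, Op Add 15 15 4, Op Div 15 4 15]"

definition compare :: program where
  "compare =
    [Op Add 21 21 23, Op Div 21 21 16, Op Add 21 21 4, Op Div 21 4 21, Op And 0 15 21]"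

definition prologue :: program where
  "prologue = read_header @ read_field 14 4 @ read_field 15 5 @ in_range"

definition lookup :: program where
  "lookup = locate @ read_field 21 18 @ [Op Add 18 18 4] @ read_field 22 18 @ table_index
    @ read_field 23 22"

definition query :: program where
  "query = prologue @ lookup @ compare"

lemma straight_query: "list_all straight query"
  by (simp add: query_def prologue_def lookup_def read_header_def read_field_def locate_def table_index_def in_range_def
      compare_def)

section \<open>Symbolic execution of the pieces of the query\<close>

lemma sub_word: "y \<le> x \<Longrightarrow> x < B \<Longrightarrow> (x + (B - y)) mod B = x - (y::nat)"
  using mod_add_self2[of "x - y" B] by (simp add: less_imp_diff_less)

lemma binop_Add: "x + y = z \<Longrightarrow> z < 2 ^ w \<Longrightarrow> binop_sem w Add x y = z"
  by simp

lemma binop_Mul: "x * y = z \<Longrightarrow> z < 2 ^ w \<Longrightarrow> binop_sem w Mul x y = z"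
  by simp

lemma one_div_Suc_div: "0 < y \<Longrightarrow> 1 div Suc (x div y) = of_bool (x < (y::nat))"
  by (auto simp: div_eq_0_iff div_greater_zero_iff not_less Suc_le_eq)

lemma reg_exec_in_range:
  assumes "r 4 = 1" "r 2 < 2 ^ w" "0 < r 15" "0 < w"
  shows "fold (reg_exec w M) in_range r = r(15 := of_bool (r 2 < r 15))"
proof (cases "r 2 div r 15 + 1 < 2 ^ w")
  case True
  then show ?thesis using assms one_div_Suc_div[of "r 15" "r 2"] by (simp add: in_range_def)
next
  case False
  then have eq: "r 2 div r 15 + 1 = 2 ^ w"
    using assms(2) div_le_dividend[of "r 2" "r 15"] by linarith
  moreover have "(2::nat) \<le> 2 ^ w" using assms(4) self_le_power[of "2::nat" w] by simp
  ultimately have "\<not> r 2 < r 15" by auto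
  then show ?thesis using assms eq by (simp add: in_range_def)
qed

lemmas run_simps = fun_upd_same fun_upd_other numeral_eq_iff num.simps simp_thms
  zero_neq_numeral numeral_eq_one_iff one_eq_numeral_iff zero_neq_one one_neq_zero numeral_neq_zero

text \<open>Every intermediate result is a named variable, which separates register bookkeeping from
  modular arithmetic.\<close>

lemma read_header_ops:
  assumes "M 0 = x" "r 6 = 0" "r 3 = w" "binop_sem w Sub x 1 = x'" "binop_sem w Xor x x' = a"
    "binop_sem w Add a 1 = p" "binop_sem w Div x p = b" "binop_sem w And b a = c"
    "binop_sem w Add c c = d" "binop_sem w Mul p a = e" "binop_sem w Add e a = f"
    "binop_sem w Div w d = g" "binop_sem w Add 1 1 = 2" "1 mod 2 ^ w = (1::nat)"
  shows "fold (reg_exec w M) read_header r =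
    r(4 := 1, 5 := 2, 6 := a, 7 := p, 8 := c, 9 := d, 10 := f, 11 := g)"
  by (simp only: read_header_def fold_simps reg_exec.simps assms run_simps) (simp add: fun_upd_def fun_eq_iff)

lemma reg_exec_read_header:
  assumes "M 0 < 2 ^ w" "take_bit (2 * F) (M 0) = 2 ^ F * F + 2 ^ (F - 1)" "0 < F" "2 * F \<le> w"
    "r 6 = 0" "r 3 = w"
  obtains x where "fold (reg_exec w M) read_header r =
    r(4 := 1, 5 := 2, 6 := x, 7 := 2 ^ F, 8 := F, 9 := 2 * F, 10 := 2 ^ (2 * F) - 1, 11 := w div (2 * F))"
proof -
  define X where "X = M 0"
  have "take_bit F (take_bit (2 * F) X) = 2 ^ (F - 1)"
    unfolding X_def assms(2) using assms(3) by (simp add: take_bit_eq_mod)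
  then have "X mod 2 ^ F = 2 ^ (F - 1)" by (simp add: take_bit_eq_mod[symmetric])
  then have "X = 2 ^ F * (X div 2 ^ F) + 2 ^ (F - 1)" by (metis mult_div_mod_eq)
  also have "\<dots> = 2 ^ (F - 1) * (2 * (X div 2 ^ F) + 1)"
    using assms(3) by (cases F) (simp_all add: algebra_simps)
  finally have Xe: "X = 2 ^ (F - 1) * (2 * (X div 2 ^ F) + 1)" .
  have xor: "xor X (X - 1) = 2 ^ F - 1"
    using xor_pred_eq_mask[of "F - 1" "X div 2 ^ F"] assms(3) unfolding Xe[symmetric] by simp
  have X1: "1 \<le> X" using Xe by (cases X) simp_all
  define p where "p = (2::nat) ^ F"
  have p: "1 \<le> p" "2 ^ (2 * F) = p * p" by (simp_all add: p_def mult_2 power_add)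
  have "2 ^ (2 * F) \<le> (2::nat) ^ w" using assms(4) by simp
  then have pp: "p * p \<le> 2 ^ w" unfolding p(2) .
  have p2: "2 \<le> p" unfolding p_def using assms(3) self_le_power[of "2::nat" F] by simp
  then have "2 * p \<le> p * p" by (rule mult_right_mono) simp
  with pp p2 have bounds: "p < 2 ^ w" "1 < (2::nat) ^ w" "2 < (2::nat) ^ w" by linarith+
  \<comment> \<open>If \<open>2 * F = w\<close>, then \<open>p * p\<close> overflows; the field mask
    \<open>p * p - 1\<close> is therefore built from this sum.\<close>
  have sq: "p * (p - 1) + (p - 1) = p * p - 1" by (cases p) simp_all
  have bounds2: "p * (p - 1) + (p - 1) < 2 ^ w" "p * (p - 1) < 2 ^ w"
    using sq pp p2 bounds by linarith+
  have F2: "2 * F < 2 ^ w" using assms(4) less_exp[of w] by linarith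
  have "take_bit F (X div p) = take_bit F (take_bit (2 * F) X div p)"
    unfolding p_def by (simp add: drop_bit_eq_div[symmetric] drop_bit_take_bit)
  also have "\<dots> = F" unfolding X_def assms(2) using assms(3) p_def by (simp add: take_bit_nat_eq_self)
  finally have F: "and (X div p) (p - 1) = F"
    unfolding p_def by (simp add: take_bit_eq_mask mask_eq_exp_minus_1)
  have sub: "(X + (2 ^ w - 1)) mod 2 ^ w = X - 1"
    using X1 assms(1) unfolding X_def by (rule sub_word)
  have w: "0 < w" using assms(3,4) by linarith
  have ops:
    "binop_sem w Sub X 1 = X - 1" "binop_sem w Xor X (X - 1) = p - 1" "binop_sem w Add (p - 1) 1 = p"
    "binop_sem w Div X p = X div p" "binop_sem w And (X div p) (p - 1) = F"
    "binop_sem w Add F F = 2 * F" "binop_sem w Mul p (p - 1) = p * (p - 1)"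
    "binop_sem w Add (p * (p - 1)) (p - 1) = p * p - 1"
    "binop_sem w Div w (2 * F) = w div (2 * F)" "binop_sem w Add 1 1 = 2" "1 mod 2 ^ w = (1::nat)"
    using sub xor F F2 sq bounds(1,3) bounds2 p(1) w
    by (simp_all only: binop_sem.simps p_def[symmetric] mult_2[symmetric] mod_less le_add_diff_inverse2
        one_add_one one_mod_2_pow_eq of_bool_eq)
  have "fold (reg_exec w M) read_header r = r(4 := 1, 5 := 2, 6 := p - 1, 7 := p,
      8 := F, 9 := 2 * F, 10 := 2 ^ (2 * F) - 1, 11 := w div (2 * F))"
    unfolding p(2) by (rule read_header_ops[where M = M and r = r, OF X_def[symmetric] assms(5,6) ops])
  then show ?thesis unfolding p_def by (rule that)
qed

lemma locate_ops:
  assumes "r 0 = i" "r 1 = j" "r 2 = k" "r 4 = 1" "r 5 = 2" "r 7 = p" "r 8 = F" "r 14 = n"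
    "binop_sem w Mul k n = a1" "binop_sem w Add a1 a1 = a2" "binop_sem w Add a2 i = a3"
    "binop_sem w Add a3 n = a4" "binop_sem w Sub a4 j = x" "binop_sem w Add a1 i = b1"
    "binop_sem w Add b1 1 = b2" "binop_sem w Div x F = q" "binop_sem w Mod x F = s"
    "binop_sem w Mul p F = c" "binop_sem w Add 2 1 = 3" "binop_sem w Add q q = d1"
    "binop_sem w Add d1 c = d2" "binop_sem w Add d2 3 = d3"
  shows "fold (reg_exec w M) locate r =
    r(16 := b2, 17 := x, 18 := d3, 19 := s, 20 := c, 5 := 3)"
  by (simp only: locate_def fold_simps reg_exec.simps assms run_simps) (simp add: fun_upd_def fun_eq_iff)

text \<open>Because \<open>k < m\<close>, all intermediate values stay below \<open>2 ^ w\<close>,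
  and adding \<open>n\<close> before subtracting \<open>j\<close> avoids wrapping below
  zero.\<close>

lemma reg_exec_locate:
  assumes "r 0 = i" "r 1 = j" "r 2 = k" "r 4 = 1" "r 5 = 2" "r 7 = 2 ^ F" "r 8 = F" "r 14 = n"
    "i < n" "j < n" "k < m" "2 * n * m + 1 < 2 ^ w" "num_fields F (2 * n * m) < 2 ^ w"
    "x = 2 * (k * n) + i + n - j"
  shows "fold (reg_exec w M) locate r =
    r(16 := k * n + i + 1, 17 := x, 18 := 2 * (x div F) + 2 ^ F * F + 3, 19 := x mod F,
      20 := 2 ^ F * F, 5 := 3)"
proof -
  have "(k + 1) * n \<le> m * n" using assms(11) by (intro mult_right_mono) simp_all
  then have kn: "2 * (k * n) + 2 * n \<le> 2 * n * m" by (simp add: algebra_simps)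
  then have xL: "x \<le> 2 * n * m" using assms(9,10,14) by linarith
  have N: "2 * (x div F) + 2 ^ F * F + 3 < 2 ^ w"
    using assms(13) div_le_mono[OF xL, of F] unfolding num_fields_def by linarith
  have ops: "binop_sem w Mul k n = k * n" "binop_sem w Add (k * n) (k * n) = 2 * (k * n)"
    "binop_sem w Add (2 * (k * n)) i = 2 * (k * n) + i"
    "binop_sem w Add (2 * (k * n) + i) n = 2 * (k * n) + i + n"
    using kn assms(9,10,12) by (auto intro!: binop_Mul binop_Add)
  have ops2: "binop_sem w Sub (2 * (k * n) + i + n) j = x"
    unfolding binop_sem.simps assms(14) using kn assms(9,10,12) by (intro sub_word) linarith+
  have ops3: "binop_sem w Add (k * n) i = k * n + i" "binop_sem w Add (k * n + i) 1 = k * n + i + 1"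
    "binop_sem w Div x F = x div F" "binop_sem w Mod x F = x mod F"
    using kn assms(9,10,12) by (auto intro!: binop_Add simp del: binop_sem.simps(1))
  have ops4: "binop_sem w Mul (2 ^ F) F = 2 ^ F * F" "binop_sem w Add 2 1 = 3"
    "binop_sem w Add (x div F) (x div F) = 2 * (x div F)"
    "binop_sem w Add (2 * (x div F)) (2 ^ F * F) = 2 * (x div F) + 2 ^ F * F"
    "binop_sem w Add (2 * (x div F) + 2 ^ F * F) 3 = 2 * (x div F) + 2 ^ F * F + 3"
    by (rule binop_Mul binop_Add; use N in linarith)+
  show ?thesis by (rule locate_ops[OF assms(1-8) ops ops2 ops3 ops4])
qed

lemma fields_header: "fields F n m G 0 = 2 ^ F * F + 2 ^ (F - 1)" "fields F n m G 1 = n"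
    "fields F n m G 2 = m"
  by (simp_all add: fields_def)

lemma fields_table:
  assumes "p < 2 ^ F" "s < F"
  shows "fields F n m G (p * F + s + 3) = delta p s"
proof -
  have "(p + 1) * F \<le> 2 ^ F * F" using assms(1) by (intro mult_right_mono) simp_all
  then show ?thesis using assms(2) by (simp add: fields_def)
qed

lemma fields_block:
  "fields F n m G (2 * q + 2 ^ F * F + 3) = G (q * F)"
  "fields F n m G (2 * q + 2 ^ F * F + 3 + 1) = pattern G F q"
proof -
  show "fields F n m G (2 * q + 2 ^ F * F + 3) = G (q * F)"
    by (simp add: fields_def)
  have "2 * q + 2 ^ F * F + 3 + 1 - (3 + 2 ^ F * F) = 2 * q + 1" by simp
  then show "fields F n m G (2 * q + 2 ^ F * F + 3 + 1) = pattern G F q"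
    by (simp add: fields_def)
qed

section \<open>Correctness of the query for an abstract Lipschitz sequence\<close>

text \<open>\<open>G\<close> stands for the chained ranks. \<open>F_large\<close> makes
  \<open>n\<close>, \<open>m\<close> and the ranks fit into fields; the last two bounds exclude
  overflow in positions and field addresses.\<close>

locale diagonal_structure =
  fixes w F n m :: nat and G :: "nat \<Rightarrow> nat"
  assumes G_mono: "G x \<le> G (Suc x)" and G_Suc_le: "G (Suc x) \<le> Suc (G x)" and G_le: "G x \<le> x"
    and n_pos: "0 < n" and m_pos: "0 < m" and F_pos: "0 < F"
    and F_large: "2 * n * m < 2 ^ (2 * F)" and F_le: "2 * F \<le> w"
    and range_less: "2 * n * m + 1 < 2 ^ w" and num_fields_less: "num_fields F (2 * n * m) < 2 ^ w"
begin

abbreviation "D \<equiv> pack w (2 * F) (num_fields F (2 * n * m)) (fields F n m G)"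
abbreviation "M \<equiv> bits_memory w D"

lemma read:
  assumes "r 9 = 2 * F" "r 10 = 2 ^ (2 * F) - 1" "r 11 = w div (2 * F)"
    "r a < num_fields F (2 * n * m)" "fields F n m G (r a) = v" "v < 2 ^ (2 * F)" "a \<noteq> 12"
  obtains u1 u2 where "fold (reg_exec w M) (read_field d a) r = r(12 := u1, 13 := u2, d := v)"
  using read_field[of r "2 * F" w a "num_fields F (2 * n * m)" "fields F n m G" d] assms F_pos F_le
  by auto

lemma reg_exec_prologue:
  assumes "r 6 = 0" "r 3 = w" "r 2 < 2 ^ w"
  obtains u1 u2 u3 where "fold (reg_exec w M) prologue r =
    r(4 := 1, 5 := 2, 6 := u1, 7 := 2 ^ F, 8 := F, 9 := 2 * F, 10 := 2 ^ (2 * F) - 1,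
      11 := w div (2 * F), 14 := n, 12 := u2, 13 := u3, 15 := of_bool (r 2 < m))"
proof -
  have "take_bit (2 * F) (M 0) = take_bit (2 * F) (2 ^ F * F + 2 ^ (F - 1))"
    using take_bit_drop_bit_pack[of "2 * F" w 0 "num_fields F (2 * n * m)" "fields F n m G"] F_pos F_le
    by (simp add: num_fields_def fields_header)
  \<comment> \<open>The header fits into one field because \<open>F + 1 <= 2 ^ F\<close>.\<close>
  moreover have "2 ^ F * F + 2 ^ (F - 1) < (2::nat) ^ (2 * F)"
  proof -
    have "(2::nat) ^ (F - 1) < 2 ^ F" using F_pos by simp
    then have "2 ^ F * F + 2 ^ (F - 1) < 2 ^ F * (F + 1)" by simp
    also have "\<dots> \<le> 2 ^ F * 2 ^ F" by (intro mult_left_mono) (simp_all add: Suc_leI)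
    finally show ?thesis by (simp add: mult_2 power_add)
  qed
  ultimately have "take_bit (2 * F) (M 0) = 2 ^ F * F + 2 ^ (F - 1)"
    by (simp add: take_bit_nat_eq_self)
  then obtain u1 where s1: "fold (reg_exec w M) read_header r = r(4 := 1, 5 := 2, 6 := u1,
      7 := 2 ^ F, 8 := F, 9 := 2 * F, 10 := 2 ^ (2 * F) - 1, 11 := w div (2 * F))" (is "_ = ?r1")
    using reg_exec_read_header[of M w F r] bits_memory_less F_pos F_le assms(1,2) by metis
  have "n \<le> 2 * n * m" "m \<le> 2 * n * m" using n_pos m_pos by simp_all
  then have nm: "n < 2 ^ (2 * F)" "m < 2 ^ (2 * F)" using F_large by linarith+
  obtain u2 u3 where s2: "fold (reg_exec w M) (read_field 14 4) ?r1 = ?r1(12 := u2, 13 := u3, 14 := n)"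
    (is "_ = ?r2")
    by (rule read[of ?r1 4 n 14]) (use nm in \<open>simp_all add: num_fields_def fields_header[unfolded One_nat_def]\<close>)
  obtain u4 u5 where s3: "fold (reg_exec w M) (read_field 15 5) ?r2 = ?r2(12 := u4, 13 := u5, 15 := m)"
    (is "_ = ?r3")
    by (rule read[of ?r2 5 m 15]) (use nm in \<open>simp_all add: num_fields_def fields_header\<close>)
  have "fold (reg_exec w M) in_range ?r3 = ?r3(15 := of_bool (?r3 2 < ?r3 15))"
    using assms(3) m_pos F_pos F_le by (intro reg_exec_in_range) simp_all
  then have "fold (reg_exec w M) prologue r = ?r3(15 := of_bool (?r3 2 < ?r3 15))"
    unfolding prologue_def fold_append comp_apply s1 s2 s3 .
  also have "\<dots> = r(4 := 1, 5 := 2, 6 := u1, 7 := 2 ^ F, 8 := F, 9 := 2 * F, 10 := 2 ^ (2 * F) - 1,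
      11 := w div (2 * F), 14 := n, 12 := u4, 13 := u5, 15 := of_bool (r 2 < m))"
    by (simp add: fun_upd_def fun_eq_iff)
  finally show ?thesis by (rule that)
qed

text \<open>Three reads give the rank at the block start, the block's pattern and the tabulated rank
  inside it; \<open>eq_add_delta_pattern\<close> adds them up.\<close>

lemma reg_exec_lookup:
  assumes "r 0 = i" "r 1 = j" "r 2 = k" "r 4 = 1" "r 5 = 2" "r 7 = 2 ^ F" "r 8 = F" "r 14 = n"
    and addr: "r 9 = 2 * F" "r 10 = 2 ^ (2 * F) - 1" "r 11 = w div (2 * F)"
    and ijk: "i < n" "j < n" "k < m"
  defines "r' \<equiv> fold (reg_exec w M) lookup r"
  shows "r' 4 = 1" "r' 15 = r 15" "r' 16 = k * n + i + 1"
    "r' 21 + r' 23 = G (2 * (k * n) + i + n - j)"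
proof -
  define x where "x = 2 * (k * n) + i + n - j"
  define q where "q = x div F"
  define p where "p = pattern G F q"
  have "(k + 1) * n \<le> m * n" using ijk(3) by (intro mult_right_mono) simp_all
  then have "2 * (k * n) + 2 * n \<le> 2 * n * m" by (simp add: algebra_simps)
  then have xL: "x \<le> 2 * n * m" unfolding x_def using ijk(1) by linarith
  then have N: "2 * q + 2 ^ F * F + 3 + 1 < num_fields F (2 * n * m)"
    using div_le_mono[of x "2 * n * m" F] unfolding num_fields_def q_def by linarith
  define a where "a = 2 * q + 2 ^ F * F + 3"
  define b where "b = p * F + x mod F + 3"
  have a: "a + 1 < num_fields F (2 * n * m)" "a < num_fields F (2 * n * m)" "a + 1 < 2 ^ w"
    "fields F n m G a = G (q * F)" "fields F n m G (a + 1) = p"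
    using N num_fields_less fields_block[of F n m G q] unfolding a_def p_def by simp_all
  note s1 = reg_exec_locate[of r i j k F n m w x M, OF assms(1-8) ijk range_less num_fields_less x_def,
      folded q_def, folded a_def]
  let ?r1 = "r(16 := k * n + i + 1, 17 := x, 18 := a, 19 := x mod F, 20 := 2 ^ F * F, 5 := 3)"
  have "G (q * F) \<le> x" using G_le[of "q * F"] unfolding q_def
    by (meson div_times_less_eq_dividend le_trans)
  then have v1: "G (q * F) < 2 ^ (2 * F)" using xL F_large by linarith
  obtain u1 u2 where s2: "fold (reg_exec w M) (read_field 21 18) ?r1 = ?r1(12 := u1, 13 := u2, 21 := G (q * F))"
    (is "_ = ?r2")
    by (rule read[of ?r1 18 "G (q * F)" 21]) (use v1 a addr in simp_all)
  have s3: "fold (reg_exec w M) [Op Add 18 18 4] ?r2 = ?r2(18 := a + 1)"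
    (is "_ = ?r3")
    using a(3) assms(4) by simp
  have p: "p < 2 ^ F" unfolding p_def by (rule pattern_less)
  also have "(2::nat) ^ F \<le> 2 ^ (2 * F)" by simp
  finally have v2: "p < 2 ^ (2 * F)" .
  obtain u3 u4 where s4: "fold (reg_exec w M) (read_field 22 18) ?r3 = ?r3(12 := u3, 13 := u4, 22 := p)"
    (is "_ = ?r4")
    by (rule read[of ?r3 18 p 22]) (use v2 a addr in simp_all)
  have xF: "x mod F < F" using F_pos by simp
  have "(p + 1) * F \<le> 2 ^ F * F" using p by (intro mult_right_mono) simp_all
  then have "b < 2 ^ F * F + 3" using xF unfolding b_def by simp
  then have b: "b < num_fields F (2 * n * m)" "b < 2 ^ w" "fields F n m G b = delta p (x mod F)"
    using num_fields_less fields_table[OF p xF] unfolding num_fields_def b_def by simp_all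
  have s5: "fold (reg_exec w M) table_index ?r4 = ?r4(22 := b)"
    (is "_ = ?r5")
    using b(2) assms(7) unfolding b_def by (simp add: table_index_def)
  have "delta p (x mod F) < F" using delta_le[of p "x mod F"] xF by linarith
  also have "F < 2 ^ F" by simp
  also have "(2::nat) ^ F \<le> 2 ^ (2 * F)" by simp
  finally have v3: "delta p (x mod F) < 2 ^ (2 * F)" .
  obtain u5 u6 where s6: "fold (reg_exec w M) (read_field 23 22) ?r5 =
      ?r5(12 := u5, 13 := u6, 23 := delta p (x mod F))"
    by (rule read[of ?r5 22 "delta p (x mod F)" 23]) (use v3 b addr in simp_all)
  have r': "r' = ?r5(12 := u5, 13 := u6, 23 := delta p (x mod F))"
    unfolding r'_def lookup_def fold_append comp_apply s1 s2 s3 s4 s5 s6 ..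
  have "G (q * F) + delta p (x mod F) = G (q * F + x mod F)"
    unfolding p_def using xF by (intro eq_add_delta_pattern[symmetric] G_mono G_Suc_le) simp
  also have "q * F + x mod F = x" unfolding q_def by simp
  finally show "r' 21 + r' 23 = G (2 * (k * n) + i + n - j)"
    unfolding r' x_def[symmetric] by simp
  show "r' 4 = 1" "r' 15 = r 15" "r' 16 = k * n + i + 1"
    unfolding r' using assms(4) by simp_all
qed

lemma reg_exec_query:
  assumes "r 0 = i" "r 1 = j" "r 2 = k" "r 3 = w" "r 6 = 0" "i < n" "j < n" "k < 2 ^ w"
  shows "fold (reg_exec w M) query r 0 =
    of_bool (k < m \<and> G (2 * (k * n) + i + n - j) \<le> k * n + i)"
proof -
  obtain u1 u2 u3 where s1: "fold (reg_exec w M) prologue r =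
    r(4 := 1, 5 := 2, 6 := u1, 7 := 2 ^ F, 8 := F, 9 := 2 * F, 10 := 2 ^ (2 * F) - 1,
      11 := w div (2 * F), 14 := n, 12 := u2, 13 := u3, 15 := of_bool (r 2 < m))" (is "_ = ?r1")
    by (rule reg_exec_prologue[of r]) (use assms in simp_all)
  define r2 where "r2 = fold (reg_exec w M) lookup ?r1"
  have query: "fold (reg_exec w M) query r = fold (reg_exec w M) compare r2"
    unfolding query_def fold_append comp_apply s1 r2_def ..
  show ?thesis
  proof (cases "k < m")
    \<comment> \<open>For \<open>k\<close> out of range the lookup may compute garbage; it never
      writes register 15, and the final \<open>And\<close> with 0 discards the garbage.\<close>
    case False
    have "r2 15 = ?r1 15" unfolding r2_def
      by (rule fold_reg_exec_unchanged)
        (simp add: lookup_def locate_def read_field_def table_index_def)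
    then have "r2 15 = 0" using False assms(3) by simp
    then show ?thesis unfolding query using False by (simp add: compare_def)
  next
    case True
    define x where "x = 2 * (k * n) + i + n - j"
    define y where "y = k * n + i"
    have r2: "r2 4 = 1" "r2 15 = ?r1 15" "r2 16 = y + 1" "r2 21 + r2 23 = G x"
      unfolding r2_def x_def y_def
      by (rule reg_exec_lookup[of ?r1 i j k]; use assms True in simp)+
    have "(k + 1) * n \<le> m * n" using True by (intro mult_right_mono) simp_all
    then have "2 * (k * n) + 2 * n \<le> 2 * n * m" by (simp add: algebra_simps)
    then have "x \<le> 2 * n * m" unfolding x_def using assms(6) by linarith
    then have Gx: "G x + 1 < 2 ^ w" using G_le[of x] range_less by linarith
    have "G x div (y + 1) \<le> G x" by (rule div_le_dividend)
    with Gx have "G x div (y + 1) + 1 < 2 ^ w" by linarith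
    then have "fold (reg_exec w M) compare r2 0 = and (r2 15) (1 div Suc (G x div (y + 1)))"
      using r2(1,3,4) Gx by (simp add: compare_def)
    also have "\<dots> = of_bool (G x \<le> y)"
      using True assms(3) one_div_Suc_div[of "y + 1" "G x"] unfolding r2(2) by (simp add: less_Suc_eq_le)
    finally show ?thesis unfolding query x_def y_def using True by simp
  qed
qed

lemma decides_within_query:
  assumes "i < n" "j < n" "k < 2 ^ w"
  shows "decides_within w query (length query) D i j k
    (k < m \<and> G (2 * (k * n) + i + n - j) \<le> k * n + i)"
  using reg_exec_query[of "reg (query_state w D i j k)" i j k] assms
    funpow_step_straight[OF straight_query, of "query_state w D i j k" "length query" w]
  by (simp add: decides_within_def Let_def halted_def query_state_def)

end

section \<open>Space bound and choice of the block length\<close>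

text \<open>Absorbs the two factors \<open>F\<close> of the table size, one for its entries and one
  for the field width. The factor 2 is needed at \<open>F = 3\<close>.\<close>

lemma square_le_two_power: "F * F \<le> 2 * (2::nat) ^ F"
proof (induction F rule: less_induct)
  case (less F)
  show ?case
  proof (cases "F < 4")
    case True
    then have "F = 0 \<or> F = 1 \<or> F = 2 \<or> F = 3" by auto
    then show ?thesis by auto
  next
    case False
    then obtain e where e: "F = Suc e" "3 \<le> e" by (cases F) auto
    have "3 * e \<le> e * e" using e(2) by (rule mult_right_mono) simp
    moreover have "Suc e * Suc e = e * e + 2 * e + 1" by simp
    ultimately have "Suc e * Suc e \<le> 2 * (e * e)" using e(2) by linarith
    then show ?thesis using less.IH[of e] e(1) by simp
  qed
qed

text \<open>The constant fields cost at most \<open>80 * L\<close> bits, the table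
  \<open>32 * L\<close> and the blocks \<open>8 * L\<close>.\<close>

lemma length_pack_fields:
  assumes "2 ^ (2 * F) \<le> 4 * L" "0 < L"
  shows "2 * num_fields F L * (2 * F) \<le> 120 * L"
proof -
  have F: "F \<le> 2 ^ F" by (rule less_imp_le) simp
  have "(2::nat) ^ F \<le> 2 ^ (2 * F)" by simp
  with F assms(1) have F20: "20 * F \<le> 80 * L" by linarith
  have "2 ^ F * (F * F) \<le> 2 ^ F * (2 * 2 ^ F)"
    by (intro mult_left_mono square_le_two_power) simp
  moreover have "2 ^ F * (2 * 2 ^ F) = 2 * (2::nat) ^ (2 * F)"
    by (simp add: power_add distrib_left flip: mult_2_right) (simp add: power_add mult_2)
  ultimately have "4 * (2 ^ F * (F * F)) \<le> 32 * L" using assms(1) by linarith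
  note F20 this
  moreover have "8 * (L div F * F) \<le> 8 * L" by simp
  moreover have "2 * num_fields F L * (2 * F) = 20 * F + 4 * (2 ^ F * (F * F)) + 8 * (L div F * F)"
    by (simp add: num_fields_def algebra_simps)
  ultimately show ?thesis by linarith
qed

theorem theorem10:
  "\<exists>(P :: program) (C :: nat) (T :: nat).
     \<forall>(n :: nat) (m :: nat) (w :: nat). \<forall>A \<in> IMS2 n m. C * n * m \<le> 2 ^ w \<longrightarrow>
       (\<exists>D :: bool list. length D \<le> C * n * m \<and>
          (\<forall>i < n. \<forall>j < n. \<forall>k < 2 ^ w. decides_within w P T D i j k (int k \<le> A i j)))"
\<comment> \<open>With \<open>L = 2 * n * m\<close>, the bound \<open>120 * L\<close> is
  \<open>240 * n * m\<close>, within the constant 256; the spare room gives the strict word-size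
  bounds.\<close>
proof (rule exI[of _ query], rule exI[of _ 256], rule exI[of _ "length query"], intro allI ballI impI)
  fix n m w :: nat and A
  assume A: "A \<in> IMS2 n m" and w: "256 * n * m \<le> 2 ^ w"
  show "\<exists>D :: bool list. length D \<le> 256 * n * m \<and> (\<forall>i < n. \<forall>j < n. \<forall>k < 2 ^ w.
    decides_within w query (length query) D i j k (int k \<le> A i j))"
  proof (cases "n = 0 \<or> m = 0")
    case True
    \<comment> \<open>For \<open>m = 0\<close> and \<open>n > 0\<close> there is no array at all;
      for \<open>n = 0\<close> there is no query.\<close>
    have "n = 0"
    proof (rule ccontr)
      assume "n \<noteq> 0"
      then have "0 \<le> A 0 0 \<and> A 0 0 < int m" using A unfolding IMS2_def by blast
      then show False using True \<open>n \<noteq> 0\<close> by simp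
    qed
    then show ?thesis by auto
  next
    case False
    define L where "L = 2 * n * m"
    have L: "2 \<le> L" "128 * L \<le> 2 ^ w"
      using False w unfolding L_def by (simp_all add: Suc_le_eq)
    \<comment> \<open>Minimality yields \<open>4 ^ F <= 4 * L\<close>, which bounds both the table
      and the field width.\<close>
    define F where "F = (LEAST F. L < 2 ^ (2 * F))"
    have "L < 2 ^ L" by simp
    also have "(2::nat) ^ L \<le> 2 ^ (2 * L)" by simp
    finally have LF: "L < 2 ^ (2 * F)" unfolding F_def by (rule LeastI)
    then have F: "0 < F" using L(1) by (cases F) auto
    then have "\<not> L < 2 ^ (2 * (F - 1))" unfolding F_def by (intro not_less_Least) simp
    moreover have "(2::nat) ^ (2 * F) = 4 * 2 ^ (2 * (F - 1))" using F by (cases F) simp_all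
    ultimately have FL: "2 ^ (2 * F) \<le> 4 * L" by linarith
    then have "(2::nat) ^ (2 * F) \<le> 2 ^ w" using L(2) by linarith
    then have Fw: "2 * F \<le> w" by simp
    have len: "2 * num_fields F L * (2 * F) \<le> 120 * L"
      using L(1) by (intro length_pack_fields[OF FL]) simp
    have "num_fields F L \<le> 2 * num_fields F L * (2 * F)" using F by simp
    then have less: "num_fields F L < 2 ^ w" "L + 1 < 2 ^ w" using len L by linarith+
    interpret diagonal_structure w F n m "rank A n"
      by unfold_locales
        (use A False F LF Fw less in \<open>simp_all only: L_def neq0_conv de_Morgan_disj rank_mono_Suc rank_Suc_le rank_le\<close>)
    have "length D \<le> 256 * n * m"
      using len unfolding L_def by (simp add: pack_def)
    moreover have "decides_within w query (length query) D i j k (int k \<le> A i j)"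
      if "i < n" "j < n" "k < 2 ^ w" for i j k
    proof -
      \<comment> \<open>Hence thresholds \<open>k \<ge> m\<close> are correctly answered negatively
        by the range test.\<close>
      have "A i j < int m" using A that unfolding IMS2_def by blast
      then have "int k \<le> A i j \<longleftrightarrow> k < m \<and> rank A n (2 * (k * n) + i + n - j) \<le> k * n + i"
        using rank_le_iff[OF A that(1,2)] by auto
      then show ?thesis using decides_within_query[OF that] by simp
    qed
    ultimately show ?thesis by blast
  qed
qed

end
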